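(* $\mathrm{HFP}(2t,4_{\mathbf u})$-codes of length $4t$ are equivalent to circulant complex Hadamard matrices of order $2t$; that is, there exists an $\mathrm{HFP}(2t,4_{\mathbf u})$-code of length $4t$ if and only if there exists a circulant complex Hadamard matrix of order $2t$.
   Context: Let $\mathbb F$ be the binary field. $C_m$ denotes the cyclic group of order $m$. $\mathbf e$ is the all-zero vector and $\mathbf u$ the all-one vector. For $\pi\in S_n$ and $x\in\mathbb F^n$, $\pi(x)=(x_{\pi^{-1}(1)},\ldots,x_{\pi^{-1}(n)})$. A Hadamard code of length $n=4t$ is a set of $2n$ binary vectors consisting of the rows of a binary Hadamard matrix (a Hadamard matrix with $1$ replaced by $0$ and $-1$ replaced by $1$) and their complements. All codes are assumed to contain $\mathbf e$. A binary code $C\subseteq\mathbb F^n$ has a propelinear structure if for each $x\in C$ there is $\pi_x\in S_n$ such that for all $y\in C$: $x+\pi_x(y)\in C$, and $\pi_x\pi_y=\pi_z$ where $z=x+\pi_x(y)$. Then $C$ is a group under $x*y=x+\pi_x(y)$ (written multiplicatively), with identity $\mathbf e$. A Hadamard full propelinear code (HFP-code) is a Hadamard code with a propelinear structure such that $\pi_x$ has no fixed coordinate for every $x\in C\setminus\{\mathbf e,\mathbf u\}$, and $\pi_{\mathbf e}=\pi_{\mathbf u}=I$. An $\mathrm{HFP}(2t,4_{\mathbf u})$-code of length $4t$ is an HFP-code $C=\langle a\rangle\times\langle b\rangle\simeq C_{2t}\times C_4$ with $a^{2t}=\mathbf e$, $b^2=\mathbf u$. A complex Hadamard matrix of order $n$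 is an $n\times n$ matrix $H$ with entries in $\{1,-1,i,-i\}$ such that $HH^{*}=nI_n$ ($H^*$ the conjugate transpose). It is circulant if its rows are the successive cyclic shifts of its first row. *)

theory Defs
  imports
    "HOL-Library.Z2"
    "HOL-Combinatorics.Permutations"
    "HOL-Algebra.Elementary_Groups"
    "Jordan_Normal_Form.Schur_Decomposition"
begin

text \<open>
  Vectors of length \<open>n\<close> over the binary field are elements of \<open>carrier_vec n :: bit vec set\<close>.
  Coordinates are numbered \<open>0, \<dots>, n - 1\<close>, and the symmetric group on them consists of the
  functions \<open>p\<close> with \<open>p permutes {..<n}\<close>.
\<close>

abbreviation all_zero :: "nat \<Rightarrow> bit vec" where
  "all_zero n \<equiv> 0\<^sub>v n"

definition all_one :: "nat \<Rightarrow> bit vec" where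
  "all_one n = vec n (\<lambda>_. 1)"

definition permute_vec :: "(nat \<Rightarrow> nat) \<Rightarrow> 'a vec \<Rightarrow> 'a vec" where
  "permute_vec p x = vec (dim_vec x) (\<lambda>i. x $ (inv_into UNIV p i))"


definition hadamard_matrix :: "nat \<Rightarrow> int mat \<Rightarrow> bool" where
  "hadamard_matrix n H \<longleftrightarrow>
     H \<in> carrier_mat n n \<and>
     (\<forall>i<n. \<forall>j<n. H $$ (i, j) \<in> {1, -1}) \<and>
     H * transpose_mat H = of_nat n \<cdot>\<^sub>m 1\<^sub>m n"

definition binary_matrix :: "int mat \<Rightarrow> bit mat" where
  "binary_matrix H = map_mat (\<lambda>x. if x = 1 then 0 else 1) H"

definition hadamard_code :: "nat \<Rightarrow> bit vec set \<Rightarrow> bool" where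
  "hadamard_code n C \<longleftrightarrow>
     (\<exists>H. hadamard_matrix n H \<and>
          C = (\<Union>i<n. {row (binary_matrix H) i, row (binary_matrix H) i + all_one n})) \<and>
     card C = 2 * n \<and>
     all_zero n \<in> C"


definition propelinear_structure ::
  "nat \<Rightarrow> bit vec set \<Rightarrow> (bit vec \<Rightarrow> nat \<Rightarrow> nat) \<Rightarrow> bool" where
  "propelinear_structure n C \<pi> \<longleftrightarrow>
     C \<subseteq> carrier_vec n \<and>
     (\<forall>x\<in>C. \<pi> x permutes {..<n}) \<and>
     (\<forall>x\<in>C. \<forall>y\<in>C.
        x + permute_vec (\<pi> x) y \<in> C \<and>
        \<pi> x \<circ> \<pi> y = \<pi> (x + permute_vec (\<pi> x) y))"

definition propelinear_group ::
  "nat \<Rightarrow> bit vec set \<Rightarrow> (bit vec \<Rightarrow> nat \<Rightarrow> nat) \<Rightarrow> bit vec monoid" where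
  "propelinear_group n C \<pi> =
     \<lparr>carrier = C, monoid.mult = (\<lambda>x y. x + permute_vec (\<pi> x) y), one = all_zero n\<rparr>"

definition hfp_code ::
  "nat \<Rightarrow> bit vec set \<Rightarrow> (bit vec \<Rightarrow> nat \<Rightarrow> nat) \<Rightarrow> bool" where
  "hfp_code n C \<pi> \<longleftrightarrow>
     hadamard_code n C \<and>
     propelinear_structure n C \<pi> \<and>
     (\<forall>x \<in> C - {all_zero n, all_one n}. \<forall>i<n. \<pi> x i \<noteq> i) \<and>
     \<pi> (all_zero n) = id \<and> \<pi> (all_one n) = id"

text \<open>
  Below, \<open>G = \<langle>a\<rangle> \<times> \<langle>b\<rangle>\<close> is an internal direct product: multiplication is an isomorphism
  from the external product of the two cyclic subgroups onto \<open>G\<close>.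
\<close>

definition hfp_2t_4u_code ::
  "nat \<Rightarrow> bit vec set \<Rightarrow> (bit vec \<Rightarrow> nat \<Rightarrow> nat) \<Rightarrow> bool" where
  "hfp_2t_4u_code t C \<pi> \<longleftrightarrow>
     hfp_code (4 * t) C \<pi> \<and>
     (let G = propelinear_group (4 * t) C \<pi> in
        \<exists>a\<in>C. \<exists>b\<in>C.
          (\<lambda>(x, y). x \<otimes>\<^bsub>G\<^esub> y)
            \<in> iso (subgroup_generated G {a} \<times>\<times> subgroup_generated G {b}) G \<and>
          subgroup_generated G {a} \<cong> integer_mod_group (2 * t) \<and>
          subgroup_generated G {b} \<cong> integer_mod_group 4 \<and>
          a [^]\<^bsub>G\<^esub> (2 * t) = all_zero (4 * t) \<and>
          b [^]\<^bsub>G\<^esub> (2::nat) = all_one (4 * t))"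


definition complex_hadamard_matrix :: "nat \<Rightarrow> complex mat \<Rightarrow> bool" where
  "complex_hadamard_matrix n H \<longleftrightarrow>
     H \<in> carrier_mat n n \<and>
     (\<forall>i<n. \<forall>j<n. H $$ (i, j) \<in> {1, -1, \<i>, -\<i>}) \<and>
     H * mat_adjoint H = of_nat n \<cdot>\<^sub>m 1\<^sub>m n"

text \<open>Row \<open>i\<close> is row \<open>0\<close> shifted cyclically by \<open>i\<close> places to the right.\<close>

definition circulant :: "nat \<Rightarrow> 'a mat \<Rightarrow> bool" where
  "circulant n H \<longleftrightarrow> (\<forall>i<n. \<forall>j<n. H $$ (i, (j + i) mod n) = H $$ (0, j))"

end

theory Submission
  imports Defs
begin

text \<open>
  Both objects are the same function in disguise. Let \<open>n = 2t\<close>. The permutation \<open>\<pi>\<^sub>x\<close> depends only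
  on the class of \<open>x\<close> modulo \<open>\<langle>u\<rangle>\<close>, and \<open>C/\<langle>u\<rangle>\<close> acts freely on the \<open>4t\<close> coordinates;
  having order \<open>4t\<close>, it acts regularly. So a coordinate is a class of \<open>C/\<langle>u\<rangle>\<close>, and the whole code is
  determined by the single function \<open>F(x) = (-1)^(x\<^sub>0)\<close> on \<open>C \<simeq> C\<^sub>n \<times> C\<^sub>4\<close>: from \<open>x * y = x + \<pi>\<^sub>x(y)\<close>
  the entry of \<open>y\<close> at the coordinate \<open>\<pi>\<^sub>x\<^sup>-\<^sup>1(0)\<close> has sign \<open>F(x) F(x * y)\<close>. Since \<open>u = b\<^sup>2\<close>, the function
  satisfies \<open>F(i, j + 2) = -F(i, j)\<close>, and orthogonality of the codewords says that the
  correlation of \<open>F\<close> with each of its translates vanishes, apart from the translates by \<open>e\<close> and \<open>u\<close>.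
  Such an \<open>F\<close> is called a Hadamard function below.

  By the sign rule \<open>F\<close> amounts to two \<open>n\<close>-periodic sequences of signs, \<open>p\<^sub>i = F(i, 0)\<close> and \<open>q\<^sub>i = F(i, 1)\<close>,
  that is, to one \<open>n\<close>-periodic sequence \<open>h\<^sub>i = (1 + \<i>)(p\<^sub>i + \<i> q\<^sub>i)/2\<close> of fourth roots of unity. Up to a
  factor of 2, the real and the imaginary part of the periodic autocorrelation of \<open>h\<close> at \<open>k\<close> are the
  correlations of \<open>F\<close> at \<open>(k, 0)\<close> and \<open>(k, 1)\<close> (\<open>complex_autocorrelation_eq_0_iff\<close>). Hence \<open>F\<close> is a
  Hadamard function iff the autocorrelation of \<open>h\<close> vanishes at every \<open>k\<close> not divisible by \<open>n\<close>, which
  means that the circulant matrix with first row \<open>h\<close> is complex Hadamard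
  (\<open>circulant_of_hadamard_function\<close>, \<open>hadamard_function_of_circulant\<close>).

  The passage from a code to \<open>F\<close> is \<open>hadamard_function_of_code\<close>. For the converse
  (\<open>code_of_hadamard_function\<close>) the formula for the entries serves as the definition of the codewords,
  with the coordinates \<open>c < 2n\<close> standing for the pairs \<open>(c div 2, c mod 2)\<close>, and the permutations are
  translations of these pairs. Elements of \<open>C\<^sub>n \<times> C\<^sub>4\<close> are written throughout as
  pairs of natural numbers, with periodicity in place of residue classes; multiplication by \<open>n - 1\<close>
  or by \<open>3\<close> then plays the role of inversion.
\<close>

section \<open>Periodic functions\<close>

lemma dvd_less_double_imp_eq:
  fixes m n :: nat
  assumes "n dvd m" "0 < m" "m < 2 * n"
  shows "m = n"
proof -
  obtain q where q: "m = n * q" using assms(1) by blast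
  then have "q < 2" using assms(3) by (simp add: mult.commute)
  then show ?thesis using q assms(2) by (cases q) auto
qed

lemma periodic_mult:
  fixes f :: "nat \<Rightarrow> 'a"
  assumes "\<And>i. f (i + n) = f i"
  shows "f (i + n * m) = f i"
proof (induction m)
  case (Suc m)
  have "f (i + n * Suc m) = f ((i + n * m) + n)" by (simp add: algebra_simps)
  then show ?case by (simp only: assms Suc)
qed simp

lemma periodic_mod:
  fixes f :: "nat \<Rightarrow> 'a"
  assumes "\<And>i. f (i + n) = f i"
  shows "f (i mod n) = f i"
  using periodic_mult[of f n "i mod n" "i div n", OF assms] by simp

lemma periodic_cong:
  fixes f :: "nat \<Rightarrow> 'a"
  assumes "\<And>i. f (i + n) = f i" "i mod n = j mod n"
  shows "f i = f j"
  using periodic_mod[of f n, OF assms(1)] assms(2) by metis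

lemma sum_periodic_shift:
  fixes f :: "nat \<Rightarrow> 'a::comm_monoid_add"
  assumes "\<And>i. f (i + n) = f i"
  shows "(\<Sum>i<n. f (i + k)) = (\<Sum>i<n. f i)"
proof (induction k)
  case (Suc k)
  show ?case
  proof (cases n)
    case (Suc m)
    have "f (m + Suc k) = f k" using assms[of k] by (simp add: Suc add.commute)
    then have "(\<Sum>i<n. f (i + Suc k)) = (\<Sum>i<n. f (i + k))"
      unfolding Suc by (subst sum.lessThan_Suc_shift) (simp add: add.commute)
    then show ?thesis using Suc.IH by simp
  qed simp
qed simp

section \<open>Hadamard functions and circulant complex Hadamard matrices\<close>

definition correlation :: "nat \<Rightarrow> (nat \<Rightarrow> nat \<Rightarrow> int) \<Rightarrow> nat \<Rightarrow> nat \<Rightarrow> int" where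
  "correlation n F k l = (\<Sum>i<n. \<Sum>j<2. F i j * F (i + k) (j + l))"

text \<open>
  The sign function of a \<open>C\<^sub>n \<times> C\<^sub>4\<close> Hadamard group with central element \<open>(0, 2)\<close>; equivalently
  \<open>F = 1\<close> cuts out a relative difference set with forbidden subgroup \<open>{(0, 0), (0, 2)}\<close>. Summing over
  \<open>j < 2\<close> in the correlation picks one element from each coset of that subgroup.
\<close>
definition hadamard_function :: "nat \<Rightarrow> (nat \<Rightarrow> nat \<Rightarrow> int) \<Rightarrow> bool" where
  "hadamard_function n F \<longleftrightarrow>
     (\<forall>i j. F i j \<in> {1, -1} \<and> F (i + n) j = F i j \<and> F i (j + 2) = - F i j) \<and>
     (\<forall>k l. \<not> (n dvd k \<and> even l) \<longrightarrow> correlation n F k l = 0)"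

lemma hadamard_functionD:
  assumes "hadamard_function n F"
  shows "F i j = 1 \<or> F i j = - 1" "F (i + n) j = F i j" "F i (j + 2) = - F i j"
  using assms by (auto simp: hadamard_function_def)

text \<open>
  The number \<open>(1 + \<i>)(p + \<i> q)/2\<close>: the factor in front rotates and scales the four points
  \<open>\<plusminus>1 \<plusminus> \<i>\<close> to the fourth roots of unity.
\<close>
definition gauss_unit :: "int \<Rightarrow> int \<Rightarrow> complex" where
  "gauss_unit p q = Complex (of_int (p - q) / 2) (of_int (p + q) / 2)"

lemma gauss_unit_range:
  assumes "p = 1 \<or> p = -1" "q = 1 \<or> q = -1"
  shows "gauss_unit p q \<in> {1, -1, \<i>, -\<i>}"
  using assms by (auto simp: gauss_unit_def complex_eq_iff)

lemma gauss_unit_cases: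
  assumes "z \<in> {1, -1, \<i>, -\<i>}"
  shows "z = gauss_unit (if z \<in> {1, \<i>} then 1 else -1) (if z \<in> {-1, \<i>} then 1 else -1)"
  using assms by (auto simp: gauss_unit_def complex_eq_iff)

lemma gauss_unit_mult_cnj:
  "2 * (gauss_unit p' q' * cnj (gauss_unit p q)) =
     Complex (of_int (p * p' + q * q')) (of_int (p * q' - q * p'))"
  by (simp add: gauss_unit_def complex_eq_iff field_simps)

text \<open>
  In the correlation at \<open>(k, 1)\<close> the term for \<open>j = 1\<close> involves \<open>F (i + k) 2 = - F (i + k) 0\<close>. This
  change of sign is what complex conjugation contributes to the imaginary part on the other side.
\<close>
lemma complex_autocorrelation_eq_0_iff:
  assumes "\<And>i j. F i (j + 2) = - F i j"
  shows "(\<Sum>m<n. gauss_unit (F (m + k) 0) (F (m + k) 1) * cnj (gauss_unit (F m 0) (F m 1))) = 0 \<longleftrightarrow>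
     correlation n F k 0 = 0 \<and> correlation n F k 1 = 0" (is "?S = 0 \<longleftrightarrow> ?R")
proof -
  have "F i 2 = - F i 0" for i using assms[of i 0] by (simp add: numeral_2_eq_2)
  then have "2 * ?S = Complex (of_int (correlation n F k 0)) (of_int (correlation n F k 1))"
    unfolding sum_distrib_left gauss_unit_mult_cnj
    by (simp add: complex_eq_iff correlation_def numeral_2_eq_2)
  moreover have "?S = 0 \<longleftrightarrow> 2 * ?S = 0" by simp
  ultimately show ?thesis by (simp only:) (simp add: complex_eq_iff)
qed

text \<open>
  A translate by \<open>(k, l)\<close> with \<open>k\<close> divisible by \<open>n\<close> and \<open>l\<close> odd costs nothing: its correlation is
  \<open>\<Sum>\<^sub>i (p\<^sub>i q\<^sub>i - q\<^sub>i p\<^sub>i)\<close>. This matches the fact that the autocorrelation of \<open>h\<close> at \<open>0\<close> is real.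
\<close>
lemma hadamard_function_correlationI:
  assumes pm: "\<And>i j. F i j = 1 \<or> F i j = - 1"
    and per: "\<And>i j. F (i + n) j = F i j" "\<And>i j. F i (j + 2) = - F i j"
    and zero: "\<And>k. \<not> n dvd k \<Longrightarrow>
      (\<Sum>m<n. gauss_unit (F (m + k) 0) (F (m + k) 1) * cnj (gauss_unit (F m 0) (F m 1))) = 0"
  shows "hadamard_function n F"
proof -
  have two: "F i 2 = - F i 0" for i using per(2)[of i 0] by (simp add: numeral_2_eq_2)
  have "correlation n F k l = 0" if "\<not> (n dvd k \<and> even l)" for k l
    using that
  proof (induction l rule: nat_induct2)
    case 0
    then show ?case
      using complex_autocorrelation_eq_0_iff[of F k n, OF per(2)] zero[of k] by blast
  next
    case 1
    show ?case
    proof (cases "n dvd k")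
      case True
      then obtain m where "k = n * m" by blast
      then have "F (i + k) j = F i j" for i j
        using periodic_mult[of "\<lambda>i. F i j" n i m] per(1) by simp
      then show ?thesis
        using two by (simp add: correlation_def numeral_2_eq_2 mult.commute sum_negf)
    next
      case False
      then show ?thesis
        using complex_autocorrelation_eq_0_iff[of F k n, OF per(2)] zero[of k] by blast
    qed
  next
    case (step l)
    have "F i j * F (i + k) (j + (l + 2)) = - (F i j * F (i + k) (j + l))" for i j
      using per(2)[of "i + k" "j + l"] by (simp add: add.assoc)
    then have "correlation n F k (l + 2) = - correlation n F k l"
      by (simp add: correlation_def sum_negf)
    then show ?case using step by simp
  qed
  then show ?thesis using pm per by (auto simp: hadamard_function_def)
qed

lemma mult_mat_adjoint_index:
  fixes H :: "complex mat"
  assumes "H \<in> carrier_mat n n" "i < n" "j < n"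
  shows "(H * mat_adjoint H) $$ (i, j) = (\<Sum>m<n. H $$ (i, m) * cnj (H $$ (j, m)))"
  using assms
  by (auto simp: mat_adjoint_def scalar_prod_def mat_of_rows_def atLeast0LessThan intro!: sum.cong)

lemma circulant_of_hadamard_function:
  assumes n: "n > 0" and F: "hadamard_function n F"
  shows "\<exists>H. complex_hadamard_matrix n H \<and> circulant n H"
proof -
  define h where "h i = gauss_unit (F i 0) (F i 1)" for i
  define H where "H = mat n n (\<lambda>(i, m). h (m + (n - i)))"
  have H_carrier: "H \<in> carrier_mat n n" by (simp add: H_def)
  have h_per: "h (i + n) = h i" for i by (simp add: h_def hadamard_functionD(2)[OF F])
  have h_mult: "h (i + n * m) = h i" for i m by (rule periodic_mult[of h n, OF h_per])
  have h_range: "h i \<in> {1, -1, \<i>, -\<i>}" for i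
    unfolding h_def by (rule gauss_unit_range) (rule hadamard_functionD(1)[OF F])+
  have norm: "h i * cnj (h i) = 1" for i using h_range[of i] by auto
  have zero: "(\<Sum>m<n. h (m + k) * cnj (h m)) = 0" if "\<not> n dvd k" for k
    unfolding h_def complex_autocorrelation_eq_0_iff[of F, OF hadamard_functionD(3)[OF F]]
    using F that by (simp add: hadamard_function_def)
  have "(\<Sum>m<n. H $$ (i, m) * cnj (H $$ (j, m))) = (if i = j then of_nat n else 0)"
    if ij: "i < n" "j < n" for i j
  proof -
    let ?f = "\<lambda>m. h (m + (n - i)) * cnj (h (m + (n - j)))"
    have "?f (m + n) = ?f m" for m
      using h_per[of "m + (n - i)"] h_per[of "m + (n - j)"] by (simp add: ac_simps)
    \<comment> \<open>Translating by \<open>j\<close> makes the second factor \<open>cnj (h m)\<close>, so only one autocorrelation remains.\<close>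
    note shift = sum_periodic_shift[of ?f n j, OF this]
    have "(\<Sum>m<n. H $$ (i, m) * cnj (H $$ (j, m))) = (\<Sum>m<n. ?f (m + j))"
      unfolding shift using ij by (simp add: H_def)
    also have "\<dots> = (\<Sum>m<n. h (m + (j + n - i)) * cnj (h m))"
      using ij h_per by (intro sum.cong) (simp_all add: add.assoc)
    also have "\<dots> = (if i = j then of_nat n else 0)"
    proof (cases "i = j")
      case True
      then show ?thesis using norm h_per by simp
    next
      case False
      have "\<not> n dvd j + n - i"
      proof
        assume "n dvd j + n - i"
        moreover have "0 < j + n - i" "j + n - i < 2 * n" using ij by linarith+
        ultimately have "j + n - i = n" by (rule dvd_less_double_imp_eq)
        then show False using False ij by linarith
      qed
      then show ?thesis using zero False by simp
    qed
    finally show ?thesis .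
  qed
  then have "H * mat_adjoint H = of_nat n \<cdot>\<^sub>m 1\<^sub>m n"
    using H_carrier mult_mat_adjoint_index[OF H_carrier]
    by (intro eq_matI) (auto simp: mat_adjoint_def)
  moreover have "circulant n H"
    unfolding circulant_def
  proof (intro allI impI)
    fix i j assume ij: "i < n" "j < n"
    have "h ((j + i) mod n + (n - i)) = h (j + i + (n - i))"
      by (rule periodic_cong[of h n, OF h_per]) (rule mod_add_left_eq)
    also have "j + i + (n - i) = j + n" using ij by simp
    finally have "h ((j + i) mod n + (n - i)) = h (j + n)" .
    then show "H $$ (i, (j + i) mod n) = H $$ (0, j)"
      using ij by (simp add: H_def)
  qed
  ultimately show ?thesis
    using h_range by (intro exI[of _ H]) (auto simp: complex_hadamard_matrix_def H_def)
qed

lemma hadamard_function_of_circulant: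
  assumes n: "n > 0" and H: "complex_hadamard_matrix n H" "circulant n H"
  shows "\<exists>F. hadamard_function n F"
proof -
  define h where "h j = H $$ (0, j mod n)" for j
  define F :: "nat \<Rightarrow> nat \<Rightarrow> int" where
    "F i j = (-1) ^ (j div 2) * (if h i \<in> (if even j then {1, \<i>} else {-1, \<i>}) then 1 else -1)" for i j
  have h_range: "h i \<in> {1, -1, \<i>, -\<i>}" for i
    using H(1) n by (auto simp: h_def complex_hadamard_matrix_def)
  have h_per: "h (i + n) = h i" for i by (simp add: h_def)
  have h_F: "gauss_unit (F i 0) (F i 1) = h i" for i
    using gauss_unit_cases[OF h_range[of i]] by (simp add: F_def)
  have zero: "(\<Sum>m<n. h (m + k) * cnj (h m)) = 0" if k: "\<not> n dvd k" for k
  proof -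
    define r where "r = k mod n"
    have r: "0 < r" "r < n" using k n by (auto simp: r_def dvd_eq_mod_eq_0)
    let ?f = "\<lambda>m. H $$ (0, m mod n) * cnj (H $$ (r, m mod n))"
    have circ: "H $$ (r, (m + r) mod n) = H $$ (0, m)" if "m < n" for m
      using H(2) r that by (auto simp: circulant_def)
    have "h (m + k) = h (m + r)" for m
      by (rule periodic_cong[of h n, OF h_per]) (simp add: r_def mod_add_right_eq)
    then have "(\<Sum>m<n. h (m + k) * cnj (h m)) = (\<Sum>m<n. ?f (m + r))"
      by (auto simp: h_def circ intro!: sum.cong)
    also have "\<dots> = (\<Sum>m<n. ?f m)" by (rule sum_periodic_shift) simp
    also have "\<dots> = (\<Sum>m<n. H $$ (0, m) * cnj (H $$ (r, m)))" by (simp cong: sum.cong_simp)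
    also have "\<dots> = (H * mat_adjoint H) $$ (0, r)"
      using H(1) r by (subst mult_mat_adjoint_index[of H n]) (auto simp: complex_hadamard_matrix_def)
    also have "\<dots> = 0" using H(1) r by (simp add: complex_hadamard_matrix_def)
    finally show ?thesis .
  qed
  have "hadamard_function n F"
  proof (rule hadamard_function_correlationI)
    show "F i j = 1 \<or> F i j = - 1" for i j
      using neg_one_even_power[of "j div 2", where 'a=int] neg_one_odd_power[of "j div 2", where 'a=int]
      by (cases "even (j div 2)") (auto simp: F_def)
    show "F (i + n) j = F i j" for i j by (simp add: F_def h_per)
    show "F i (j + 2) = - F i j" for i j by (simp add: F_def)
    show "(\<Sum>m<n. gauss_unit (F (m + k) 0) (F (m + k) 1) * cnj (gauss_unit (F m 0) (F m 1))) = 0"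
      if "\<not> n dvd k" for k
      unfolding h_F by (rule zero[OF that])
  qed
  then show ?thesis by blast
qed

section \<open>Hadamard codes and propelinear groups\<close>

definition bit_sign :: "bit \<Rightarrow> int" where
  "bit_sign x = (if x = 0 then 1 else -1)"

lemma bit_sign_add: "bit_sign (x + y) = bit_sign x * bit_sign y"
  by (cases x; cases y) (simp_all add: bit_sign_def)

lemma bit_sign_if: "bit_sign (if P then 0 else 1) = (if P then 1 else -1)"
  by (simp add: bit_sign_def)

lemma bit_sign_eq_iff: "bit_sign x = bit_sign y \<longleftrightarrow> x = y"
  by (cases x; cases y) (simp_all add: bit_sign_def)

lemma all_one_simps [simp]: "dim_vec (all_one n) = n" "all_one n \<in> carrier_vec n"
    "c < n \<Longrightarrow> all_one n $ c = 1"
  by (simp_all add: all_one_def)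

lemma add_all_one_twice:
  assumes "x \<in> carrier_vec n"
  shows "x + all_one n + all_one n = x"
  using assms by (intro eq_vecI) (auto simp: add.assoc)

lemma hadamard_code_rowE:
  assumes H: "hadamard_matrix n H"
    and x: "x \<in> (\<Union>i<n. {row (binary_matrix H) i, row (binary_matrix H) i + all_one n})"
  obtains i e where "i < n" "e = 1 \<or> e = (-1::int)"
    "\<And>c. c < n \<Longrightarrow> bit_sign (x $ c) = e * H $$ (i, c)"
    "x = row (binary_matrix H) i \<or> x = row (binary_matrix H) i + all_one n"
proof -
  from x obtain i where i: "i < n"
      "x = row (binary_matrix H) i \<or> x = row (binary_matrix H) i + all_one n"
    by auto
  have row: "bit_sign (row (binary_matrix H) i $ c) = H $$ (i, c)" if "c < n" for c
    using H i(1) that by (auto simp: hadamard_matrix_def binary_matrix_def bit_sign_if) metis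
  have "dim_vec (row (binary_matrix H) i) = n"
    using H i(1) by (auto simp: hadamard_matrix_def binary_matrix_def)
  then have "bit_sign (x $ c) = (if x = row (binary_matrix H) i then 1 else -1) * H $$ (i, c)"
    if "c < n" for c
    using i(2) row[OF that] that by (auto simp: bit_sign_add) (auto simp: bit_sign_def)
  then show ?thesis using that[OF i(1) _ _ i(2)] by (metis (full_types))
qed

lemma hadamard_code_orthogonal:
  assumes C: "hadamard_code n C" and xy: "x \<in> C" "y \<in> C" "x \<noteq> y" "x \<noteq> y + all_one n"
  shows "(\<Sum>c<n. bit_sign (x $ c) * bit_sign (y $ c)) = 0"
proof -
  obtain H where H: "hadamard_matrix n H"
      and C_eq: "C = (\<Union>i<n. {row (binary_matrix H) i, row (binary_matrix H) i + all_one n})"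
    using C by (auto simp: hadamard_code_def)
  obtain i e where i: "i < n" "e = 1 \<or> e = (-1::int)"
      "\<And>c. c < n \<Longrightarrow> bit_sign (x $ c) = e * H $$ (i, c)"
      "x = row (binary_matrix H) i \<or> x = row (binary_matrix H) i + all_one n"
    by (rule hadamard_code_rowE[OF H xy(1)[unfolded C_eq]]) blast
  obtain j d where j: "j < n" "d = 1 \<or> d = (-1::int)"
      "\<And>c. c < n \<Longrightarrow> bit_sign (y $ c) = d * H $$ (j, c)"
      "y = row (binary_matrix H) j \<or> y = row (binary_matrix H) j + all_one n"
    by (rule hadamard_code_rowE[OF H xy(2)[unfolded C_eq]]) blast
  have Hc: "H \<in> carrier_mat n n" using H by (simp add: hadamard_matrix_def)
  have "row (binary_matrix H) i \<in> carrier_vec n"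
    using Hc i(1) by (auto simp: binary_matrix_def)
  note twice = add_all_one_twice[OF this]
  have "i \<noteq> j"
  proof
    assume "i = j"
    then have "x = y \<or> x = y + all_one n" using i(4) j(4) twice by auto
    then show False using xy(3,4) by blast
  qed
  then have "(H * transpose_mat H) $$ (i, j) = 0"
    using H i(1) j(1) by (simp add: hadamard_matrix_def)
  moreover have "(H * transpose_mat H) $$ (i, j) = (\<Sum>c<n. H $$ (i, c) * H $$ (j, c))"
    using Hc i(1) j(1) by (auto simp: scalar_prod_def atLeast0LessThan)
  moreover have "(\<Sum>c<n. bit_sign (x $ c) * bit_sign (y $ c))
      = e * d * (\<Sum>c<n. H $$ (i, c) * H $$ (j, c))"
    unfolding sum_distrib_left using i(3) j(3) by (intro sum.cong) auto
  ultimately show ?thesis by simp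
qed

lemma permute_vec_carrier [simp]: "permute_vec p x \<in> carrier_vec n \<longleftrightarrow> x \<in> carrier_vec n"
  by (simp only: permute_vec_def carrier_vec_def mem_Collect_eq dim_vec)

lemma permute_vec_id [simp]: "permute_vec id x = x"
  by (auto simp: permute_vec_def inv_id)

lemma permutes_inv_less: "p permutes {..<n} \<Longrightarrow> c < n \<Longrightarrow> inv_into UNIV p c < (n::nat)"
  by (metis permutes_inv permutes_in_image lessThan_iff)

lemma permute_vec_add:
  assumes "p permutes {..<n}" "x \<in> carrier_vec n" "y \<in> carrier_vec n"
  shows "permute_vec p (x + y) = permute_vec p x + permute_vec p y"
  using assms by (intro eq_vecI) (auto simp: permute_vec_def permutes_inv_less)

lemma permute_vec_compose:
  assumes "p permutes {..<n}" "q permutes {..<n}" "x \<in> carrier_vec n"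
  shows "permute_vec p (permute_vec q x) = permute_vec (p \<circ> q) x"
proof -
  have "inv_into UNIV (p \<circ> q) = inv_into UNIV q \<circ> inv_into UNIV p"
    using assms(1,2) by (intro o_inv_distrib) (auto simp: permutes_bij)
  then show ?thesis
    using assms by (intro eq_vecI) (auto simp: permute_vec_def permutes_inv_less)
qed

text \<open>
  The structure supplies no inverses. In a finite code they come for free: left translations are
  injective, hence surjective, so every element has a right inverse, and in a monoid this suffices.
\<close>
lemma propelinear_group_is_group:
  assumes C: "propelinear_structure n C \<pi>" and fin: "finite C"
    and zero: "all_zero n \<in> C" "\<pi> (all_zero n) = id"
  shows "group (propelinear_group n C \<pi>)"
proof -
  define m where "m x y = x + permute_vec (\<pi> x) y" for x y
  have cv: "x \<in> carrier_vec n" and perm: "\<pi> x permutes {..<n}" if "x \<in> C" for x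
    using C that by (auto simp: propelinear_structure_def)
  have closed: "m x y \<in> C" and comp: "\<pi> (m x y) = \<pi> x \<circ> \<pi> y" if "x \<in> C" "y \<in> C" for x y
    using C that by (auto simp: propelinear_structure_def m_def)
  have assoc: "m (m x y) z = m x (m y z)" if "x \<in> C" "y \<in> C" "z \<in> C" for x y z
  proof -
    have "m x (m y z) = x + (permute_vec (\<pi> x) y + permute_vec (\<pi> x \<circ> \<pi> y) z)"
      using that cv perm
      by (simp add: m_def permute_vec_add[of _ n] permute_vec_compose[of _ n])
    also have "\<dots> = m (m x y) z"
      unfolding comp[OF that(1,2), symmetric]
      using that cv by (simp add: m_def assoc_add_vec[of _ n])
    finally show ?thesis by simp
  qed
  have lid: "m (all_zero n) x = x" if "x \<in> C" for x
    using zero cv[OF that] by (simp add: m_def)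
  have rid: "m x (all_zero n) = x" if "x \<in> C" for x
  proof -
    have "permute_vec (\<pi> x) (all_zero n) = all_zero n"
      using perm[OF that] by (intro eq_vecI) (auto simp: permute_vec_def permutes_inv_less)
    then show ?thesis using cv[OF that] by (simp add: m_def)
  qed
  have inj: "inj_on (m x) C" if x: "x \<in> C" for x
  proof (rule inj_onI)
    fix y z assume yz: "y \<in> C" "z \<in> C" "m x y = m x z"
    have "permute_vec (\<pi> x) y = permute_vec (\<pi> x) z"
    proof (rule eq_vecI)
      fix c assume "c < dim_vec (permute_vec (\<pi> x) z)"
      then have c: "c < n" using cv[OF yz(2)] by (simp add: permute_vec_def)
      have "m x v $ c = x $ c + permute_vec (\<pi> x) v $ c" if "v \<in> C" for v
        unfolding m_def using c cv[OF that] by (intro index_add_vec(1)) (simp add: permute_vec_def)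
      then have "x $ c + permute_vec (\<pi> x) y $ c = x $ c + permute_vec (\<pi> x) z $ c"
        using yz by metis
      then show "permute_vec (\<pi> x) y $ c = permute_vec (\<pi> x) z $ c"
        by (rule add_left_imp_eq)
    qed (use cv[OF yz(1)] cv[OF yz(2)] in \<open>simp add: permute_vec_def\<close>)
    then have "permute_vec (inv_into UNIV (\<pi> x)) (permute_vec (\<pi> x) y)
        = permute_vec (inv_into UNIV (\<pi> x)) (permute_vec (\<pi> x) z)" by simp
    then show "y = z"
      using perm[OF x] cv[OF yz(1)] cv[OF yz(2)]
      by (simp add: permute_vec_compose[of _ n] permutes_inv permutes_inv_o)
  qed
  have right_inv: "\<exists>y\<in>C. m x y = all_zero n" if x: "x \<in> C" for x
  proof -
    have "m x ` C = C" using inj[OF x] closed[OF x] fin by (intro endo_inj_surj) auto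
    then show ?thesis using zero(1) by (metis imageE)
  qed
  have left_inv: "\<exists>y\<in>C. m y x = all_zero n" if x: "x \<in> C" for x
  proof -
    obtain y where y: "y \<in> C" "m x y = all_zero n" using right_inv[OF x] by blast
    obtain z where z: "z \<in> C" "m y z = all_zero n" using right_inv[OF y(1)] by blast
    have "x = z" using assoc[OF x y(1) z(1)] y(2) z(2) lid[OF z(1)] rid[OF x] by simp
    then show ?thesis using y z by blast
  qed
  show ?thesis
    by (rule groupI) (auto simp: propelinear_group_def zero closed[unfolded m_def]
      assoc[unfolded m_def] lid[unfolded m_def, simplified zero(2) permute_vec_id] left_inv[unfolded m_def])
qed

section \<open>Cyclic subgroups\<close>

lemma (in group) carrier_subgroup_generated_torsion:
  assumes x: "x \<in> carrier G" "x [^] n = \<one>" and n: "n > 0"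
  shows "carrier (subgroup_generated G {x}) = (\<lambda>i::nat. x [^] i) ` {..<n}"
proof -
  have red: "x [^] k = x [^] nat (k mod int n)" for k :: int
  proof -
    have "x [^] k = x [^] (int n * (k div int n) + k mod int n)" by simp
    also have "\<dots> = (x [^] int n) [^] (k div int n) \<otimes> x [^] (k mod int n)"
      unfolding int_pow_mult[OF x(1)] int_pow_pow[OF x(1)] ..
    also have "\<dots> = x [^] (k mod int n)" using x by (simp add: int_pow_int int_pow_one)
    also have "\<dots> = x [^] nat (k mod int n)"
      using n by (simp flip: int_pow_int)
    finally show ?thesis .
  qed
  have "range (\<lambda>k::int. x [^] k) = (\<lambda>i::nat. x [^] i) ` {..<n}"
  proof (intro equalityI subsetI)
    fix y assume "y \<in> range (\<lambda>k::int. x [^] k)"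
    then obtain k :: int where "y = x [^] nat (k mod int n)" using red by auto
    moreover have "nat (k mod int n) < n" using n by (simp add: nat_less_iff)
    ultimately show "y \<in> (\<lambda>i::nat. x [^] i) ` {..<n}" by blast
  qed (auto simp flip: int_pow_int)
  then show ?thesis using carrier_subgroup_generated_by_singleton[OF x(1)] by simp
qed

lemma (in group) pow_eq_one_iff_of_iso:
  assumes x: "x \<in> carrier G" "x [^] n = \<one>" and n: "n > 0"
    and iso: "subgroup_generated G {x} \<cong> integer_mod_group n"
  shows "x [^] (i::nat) = \<one> \<longleftrightarrow> n dvd i"
proof -
  have per: "x [^] (k + n) = x [^] k" for k :: nat
    using x by (simp add: nat_pow_mult[symmetric])
  have "card (carrier (subgroup_generated G {x})) = card (carrier (integer_mod_group n))"
    using iso by (auto simp: is_iso_def iso_def bij_betw_same_card)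
  then have "card ((\<lambda>i::nat. x [^] i) ` {..<n}) = card {..<n}"
    using n carrier_subgroup_generated_torsion[OF x n] by (simp add: carrier_integer_mod_group)
  then have inj: "inj_on (\<lambda>i::nat. x [^] i) {..<n}" by (intro eq_card_imp_inj_on) auto
  have "x [^] i = \<one> \<longleftrightarrow> x [^] (i mod n) = x [^] (0::nat)"
    using periodic_mod[of "\<lambda>k. x [^] k" n i, OF per] by simp
  also have "\<dots> \<longleftrightarrow> i mod n = 0"
    using n by (subst inj_on_eq_iff[OF inj]) auto
  finally show ?thesis by (simp add: dvd_eq_mod_eq_0)
qed

lemma (in group) subgroup_generated_iso_integer_mod_group:
  assumes x: "x \<in> carrier G" "x [^] n = \<one>" and n: "n > 0"
    and inj: "inj_on (\<lambda>i::nat. x [^] i) {..<n}"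
  shows "subgroup_generated G {x} \<cong> integer_mod_group n"
proof -
  have per: "x [^] (k + n) = x [^] k" for k :: nat
    using x by (simp add: nat_pow_mult[symmetric])
  have "(\<lambda>k. x [^] nat k) \<in> iso (integer_mod_group n) (subgroup_generated G {x})"
    unfolding iso_def
  proof (intro CollectI conjI)
    have img: "nat ` {0..<int n} = {..<n}"
      by (auto simp: image_iff intro!: bexI[of _ "int _"])
    then have img': "(\<lambda>k. x [^] nat k) ` {0..<int n} = carrier (subgroup_generated G {x})"
      unfolding carrier_subgroup_generated_torsion[OF x n] by (metis image_image)
    have "inj_on ((\<lambda>i::nat. x [^] i) \<circ> nat) {0..<int n}"
      using inj by (intro comp_inj_on) (auto simp: img inj_on_def)
    then show "bij_betw (\<lambda>k. x [^] nat k) (carrier (integer_mod_group n))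
        (carrier (subgroup_generated G {x}))"
      using n img' by (simp add: bij_betw_def carrier_integer_mod_group comp_def)
    show "(\<lambda>k. x [^] nat k) \<in> hom (integer_mod_group n) (subgroup_generated G {x})"
    proof (rule homI)
      fix k assume "k \<in> carrier (integer_mod_group n)"
      then show "x [^] nat k \<in> carrier (subgroup_generated G {x})"
        using n img' by (auto simp: carrier_integer_mod_group)
    next
      fix k l assume kl: "k \<in> carrier (integer_mod_group n)" "l \<in> carrier (integer_mod_group n)"
      have "nat ((k + l) mod int n) = (nat k + nat l) mod n"
        using kl n by (simp add: carrier_integer_mod_group nat_mod_distrib nat_add_distrib)
      then show "x [^] nat (k \<otimes>\<^bsub>integer_mod_group n\<^esub> l)
          = x [^] nat k \<otimes>\<^bsub>subgroup_generated G {x}\<^esub> x [^] nat l"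
        using periodic_mod[of "\<lambda>k. x [^] k" n, OF per] x(1) by (simp add: nat_pow_mult)
    qed
  qed
  then show ?thesis using group.iso_sym[OF group_integer_mod_group] by (auto simp: is_iso_def)
qed

section \<open>From codes to Hadamard functions\<close>

text \<open>
  The elements \<open>g i j = a\<^sup>i b\<^sup>j\<close>. The rule for their product is the homomorphism property of the
  internal direct product, so commutativity of the group is never argued separately; the last
  property rests on its injectivity together with the orders of \<open>a\<close> and \<open>b\<close>.
\<close>
lemma hfp_2t_4u_code_elements:
  assumes t: "t \<ge> 1" and C: "hfp_2t_4u_code t C \<pi>"
  obtains g :: "nat \<Rightarrow> nat \<Rightarrow> bit vec" where
    "\<And>i j. g i j \<in> C"
    "\<And>i j k l. g i j + permute_vec (\<pi> (g i j)) (g k l) = g (i + k) (j + l)"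
    "\<And>i j. g (i + 2 * t) j = g i j"
    "\<And>i j. g i (j + 2) = all_one (4 * t) + g i j"
    "\<And>i j. g i j \<in> {all_zero (4 * t), all_one (4 * t)} \<longleftrightarrow> 2 * t dvd i \<and> even j"
proof -
  define G where "G = propelinear_group (4 * t) C \<pi>"
  have hfp: "hfp_code (4 * t) C \<pi>" using C by (simp add: hfp_2t_4u_code_def)
  have fin: "finite C"
    using hfp t by (intro card_ge_0_finite) (simp add: hfp_code_def hadamard_code_def)
  interpret group G
    unfolding G_def using hfp fin
    by (intro propelinear_group_is_group) (auto simp: hfp_code_def hadamard_code_def)
  have G_simps: "carrier G = C" "x \<otimes>\<^bsub>G\<^esub> y = x + permute_vec (\<pi> x) y" "\<one>\<^bsub>G\<^esub> = all_zero (4 * t)"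
    for x y by (simp_all add: G_def propelinear_group_def)
  obtain a b where ab_C: "a \<in> C" "b \<in> C"
      and iso: "(\<lambda>(x, y). x \<otimes>\<^bsub>G\<^esub> y)
            \<in> iso (subgroup_generated G {a} \<times>\<times> subgroup_generated G {b}) G"
      and iso_a: "subgroup_generated G {a} \<cong> integer_mod_group (2 * t)"
      and iso_b: "subgroup_generated G {b} \<cong> integer_mod_group 4"
      and a_pow_zero: "a [^]\<^bsub>G\<^esub> (2 * t) = all_zero (4 * t)"
      and b_pow: "b [^]\<^bsub>G\<^esub> (2::nat) = all_one (4 * t)"
    using C unfolding hfp_2t_4u_code_def Let_def G_def[symmetric] by blast
  have ab: "a \<in> carrier G" "b \<in> carrier G" and a_pow: "a [^]\<^bsub>G\<^esub> (2 * t) = \<one>\<^bsub>G\<^esub>"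
    using ab_C a_pow_zero by (simp_all add: G_simps)
  define g where "g i j = a [^]\<^bsub>G\<^esub> i \<otimes>\<^bsub>G\<^esub> b [^]\<^bsub>G\<^esub> j" for i j :: nat
  have u: "all_one (4 * t) \<in> C" using b_pow ab(2) nat_pow_closed[of b 2] by (simp add: G_simps)
  have u_mult: "all_one (4 * t) \<otimes>\<^bsub>G\<^esub> x = all_one (4 * t) + x" for x
    using hfp by (simp add: G_simps hfp_code_def)
  have "b [^]\<^bsub>G\<^esub> (4::nat) = b [^]\<^bsub>G\<^esub> (2::nat) \<otimes>\<^bsub>G\<^esub> b [^]\<^bsub>G\<^esub> (2::nat)"
    using ab by (simp add: nat_pow_mult)
  also have "\<dots> = \<one>\<^bsub>G\<^esub>"
    unfolding b_pow u_mult by (simp add: G_simps) (intro eq_vecI, auto)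
  finally have b_pow4: "b [^]\<^bsub>G\<^esub> (4::nat) = \<one>\<^bsub>G\<^esub>" .
  have ord_a: "a [^]\<^bsub>G\<^esub> i = \<one>\<^bsub>G\<^esub> \<longleftrightarrow> 2 * t dvd i" for i :: nat
    using pow_eq_one_iff_of_iso[OF ab(1) a_pow _ iso_a] t by simp
  have ord_b: "b [^]\<^bsub>G\<^esub> j = \<one>\<^bsub>G\<^esub> \<longleftrightarrow> 4 dvd j" for j :: nat
    using pow_eq_one_iff_of_iso[OF ab(2) b_pow4 _ iso_b] by simp
  have pow_gen: "x [^]\<^bsub>G\<^esub> i \<in> carrier (subgroup_generated G {x})" if "x \<in> carrier G"
    for x and i :: nat
    using carrier_subgroup_generated_by_singleton[OF that] by (auto simp flip: int_pow_int)
  have g_closed: "g i j \<in> carrier G" for i j using ab by (simp add: g_def)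
  have g_mult: "g i j \<otimes>\<^bsub>G\<^esub> g k l = g (i + k) (j + l)" for i j k l
  proof -
    have "(a [^]\<^bsub>G\<^esub> i \<otimes>\<^bsub>G\<^esub> a [^]\<^bsub>G\<^esub> k) \<otimes>\<^bsub>G\<^esub> (b [^]\<^bsub>G\<^esub> j \<otimes>\<^bsub>G\<^esub> b [^]\<^bsub>G\<^esub> l) = g i j \<otimes>\<^bsub>G\<^esub> g k l"
      using hom_mult[of "\<lambda>(x, y). x \<otimes>\<^bsub>G\<^esub> y" "subgroup_generated G {a} \<times>\<times> subgroup_generated G {b}" G
          "(a [^]\<^bsub>G\<^esub> i, b [^]\<^bsub>G\<^esub> j)" "(a [^]\<^bsub>G\<^esub> k, b [^]\<^bsub>G\<^esub> l)"]
        iso pow_gen ab by (auto simp: iso_def g_def)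
    then show ?thesis using ab by (simp add: g_def nat_pow_mult)
  qed
  have g_inj: "a [^]\<^bsub>G\<^esub> i = a [^]\<^bsub>G\<^esub> k \<and> b [^]\<^bsub>G\<^esub> j = b [^]\<^bsub>G\<^esub> l"
    if "g i j = g k l" for i j k l
  proof -
    have "inj_on (\<lambda>(x, y). x \<otimes>\<^bsub>G\<^esub> y)
        (carrier (subgroup_generated G {a}) \<times> carrier (subgroup_generated G {b}))"
      using iso by (auto simp: iso_def bij_betw_def)
    from inj_onD[OF this, of "(a [^]\<^bsub>G\<^esub> i, b [^]\<^bsub>G\<^esub> j)" "(a [^]\<^bsub>G\<^esub> k, b [^]\<^bsub>G\<^esub> l)"]
    show ?thesis using that pow_gen ab by (auto simp: g_def)
  qed
  have g_zero: "g 0 0 = all_zero (4 * t)" by (simp add: g_def flip: G_simps)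
  have g_u: "g 0 2 = all_one (4 * t)" using b_pow u by (simp add: g_def G_simps(1))
  show thesis
  proof (rule that[of g])
    show "g i j \<in> C" for i j using g_closed by (simp add: G_simps)
    show "g i j + permute_vec (\<pi> (g i j)) (g k l) = g (i + k) (j + l)" for i j k l
      using g_mult by (simp add: G_simps)
    show "g (i + 2 * t) j = g i j" for i j
      using ab a_pow by (simp add: g_def nat_pow_mult[symmetric])
    show g_add_u: "g i (j + 2) = all_one (4 * t) + g i j" for i j
      using g_mult[of 0 2 i j] by (simp add: g_u u_mult add.commute)
    have g_add4: "g i (j + 4) = g i j" for i j
      using ab b_pow4 by (simp add: g_def nat_pow_mult[symmetric])
    show "g i j \<in> {all_zero (4 * t), all_one (4 * t)} \<longleftrightarrow> 2 * t dvd i \<and> even j" for i j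
    proof
      assume "g i j \<in> {all_zero (4 * t), all_one (4 * t)}"
      then have "g i j = g 0 0 \<or> g i j = g 0 2" using g_zero g_u by auto
      then have "g i j = g 0 0 \<or> g i (j + 2) = g 0 4"
        using g_mult[of i j 0 2] g_mult[of 0 2 0 2] by auto
      then have "2 * t dvd i \<and> (4 dvd j \<or> 4 dvd (j + 2))"
      proof
        assume "g i j = g 0 0"
        from g_inj[OF this] show ?thesis using ord_a[of i] ord_b[of j] by simp
      next
        assume "g i (j + 2) = g 0 4"
        from g_inj[OF this] show ?thesis
          using ord_a[of i] ord_b[of "j + 2"] b_pow4 by (metis nat_pow_0)
      qed
      moreover have "even j" if "4 dvd j \<or> 4 dvd (j + 2)" using that by presburger
      ultimately show "2 * t dvd i \<and> even j" by blast
    next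
      assume ij: "2 * t dvd i \<and> even j"
      have "4 dvd j \<or> 4 dvd (j + 2)" using conjunct2[OF ij] by presburger
      then show "g i j \<in> {all_zero (4 * t), all_one (4 * t)}"
      proof
        assume "4 dvd j"
        then have "g i j = g 0 0" using ij ord_a[of i] ord_b[of j] by (simp add: g_def)
        then show ?thesis by (simp add: g_zero)
      next
        assume "4 dvd (j + 2)"
        then have "g i (j + 2) = g 0 0" using ij ord_a[of i] ord_b[of "j + 2"] by (simp add: g_def)
        moreover have "g i (j + 2 + 2) = all_one (4 * t) + g i (j + 2)" by (rule g_add_u)
        moreover have "j + 2 + 2 = j + 4" by simp
        ultimately have "g i (j + 4) = all_one (4 * t) + all_zero (4 * t)"
          by (simp only: g_zero)
        then have "g i j = all_one (4 * t)" unfolding g_add4 by simp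
        then show ?thesis by simp
      qed
    qed
  qed
qed

lemma hadamard_function_of_code:
  assumes t: "t \<ge> 1" and C: "hfp_2t_4u_code t C \<pi>"
  shows "\<exists>F. hadamard_function (2 * t) F"
proof (rule hfp_2t_4u_code_elements[OF t C])
  fix g :: "nat \<Rightarrow> nat \<Rightarrow> bit vec"
  assume g_C: "\<And>i j. g i j \<in> C"
    and g_mult: "\<And>i j k l. g i j + permute_vec (\<pi> (g i j)) (g k l) = g (i + k) (j + l)"
    and g_per: "\<And>i j. g (i + 2 * t) j = g i j"
    and g_u: "\<And>i j. g i (j + 2) = all_one (4 * t) + g i j"
    and g_triv: "\<And>i j. g i j \<in> {all_zero (4 * t), all_one (4 * t)} \<longleftrightarrow> 2 * t dvd i \<and> even j"
  have hfp: "hfp_code (4 * t) C \<pi>" using C by (simp add: hfp_2t_4u_code_def)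
  have dim: "dim_vec (g i j) = 4 * t" and perm: "\<pi> (g i j) permutes {..<4 * t}" for i j
    using hfp g_C[of i j] carrier_vecD[of "g i j" "4 * t"]
    unfolding hfp_code_def propelinear_structure_def by blast+
  have \<pi>_mult: "\<pi> (g i j) (\<pi> (g k l) c) = \<pi> (g (i + k) (j + l)) c" for i j k l c
  proof -
    have "\<pi> (g i j) \<circ> \<pi> (g k l) = \<pi> (g i j + permute_vec (\<pi> (g i j)) (g k l))"
      using hfp g_C unfolding hfp_code_def propelinear_structure_def by blast
    then show ?thesis unfolding g_mult by (metis comp_apply)
  qed
  have code: "hadamard_code (4 * t) C" using hfp unfolding hfp_code_def by blast
  then have zero: "all_zero (4 * t) \<in> C" unfolding hadamard_code_def by blast
  have free: "2 * t dvd i \<and> even j" if "\<pi> (g i j) c = c" "c < 4 * t" for i j c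
    using hfp g_C[of i j] that g_triv[of i j] by (auto simp: hfp_code_def)
  define F where "F i j = bit_sign (g i j $ 0)" for i j
  \<comment> \<open>Identifies the class of \<open>g i j\<close> modulo \<open>u\<close> with the coordinate that \<open>\<pi> (g i j)\<close> moves to \<open>0\<close>.\<close>
  define \<gamma> where "\<gamma> = (\<lambda>(i, j). inv_into UNIV (\<pi> (g i j)) 0)"
  have \<gamma>_less: "\<gamma> ij < 4 * t" for ij
    using t by (auto simp: \<gamma>_def split: prod.split intro: permutes_inv_less[OF perm])
  have \<pi>_\<gamma>: "\<pi> (g i j) (\<gamma> (i, j)) = 0" for i j
    unfolding \<gamma>_def prod.case by (rule permutes_inverses(1)[OF perm])
  have g_\<gamma>: "bit_sign (g k l $ \<gamma> (i, j)) = F i j * F (i + k) (j + l)" for i j k l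
  proof -
    have "(g i j + permute_vec (\<pi> (g i j)) (g k l)) $ 0 = g i j $ 0 + g k l $ \<gamma> (i, j)"
      using t by (simp add: permute_vec_def dim \<gamma>_def)
    then have "F (i + k) (j + l) = F i j * bit_sign (g k l $ \<gamma> (i, j))"
      unfolding g_mult F_def by (simp only: bit_sign_add)
    then show ?thesis by (simp add: F_def bit_sign_def)
  qed
  have "inj_on \<gamma> ({..<2 * t} \<times> {..<2})"
  proof (rule inj_onI, clarify)
    fix i j k l
    assume ij: "i < 2 * t" "j < (2::nat)" and kl: "k < 2 * t" "l < (2::nat)"
      and eq: "\<gamma> (i, j) = \<gamma> (k, l)"
    \<comment> \<open>The first index represents \<open>i - k\<close>, the second has the parity of \<open>j - l\<close>. The element with these
      indices is \<open>g i j\<close> times the inverse of \<open>g k l\<close>, up to \<open>u\<close>, and its permutation fixes \<open>0\<close>.\<close>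
    let ?i = "i + (2 * t - k)" and ?j = "j + l"
    have "\<pi> (g ?i (j + l)) 0 = \<pi> (g ?i (j + l)) (\<pi> (g k l) (\<gamma> (k, l)))"
      by (simp add: \<pi>_\<gamma>)
    also have "\<dots> = \<pi> (g (i + 2 * t) (j + 2 * l)) (\<gamma> (k, l))"
    proof -
      have "?i + k = i + 2 * t" "j + l + l = j + 2 * l" using kl by simp_all
      then show ?thesis unfolding \<pi>_mult by (simp only:)
    qed
    also have "\<dots> = \<pi> (g 0 (2 * l)) (\<pi> (g i j) (\<gamma> (i, j)))"
      by (simp add: \<pi>_mult g_per eq add.commute)
    also have "\<dots> = 0"
      using hfp g_triv[of 0 "2 * l"] by (auto simp: hfp_code_def \<pi>_\<gamma>)
    finally have "2 * t dvd ?i \<and> even ?j" by (rule free) (use t in simp)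
    moreover from this have "?i = 2 * t"
      using ij kl by (intro dvd_less_double_imp_eq) auto
    then have "i = k" using kl by simp
    moreover have "j = 0 \<or> j = 1" "l = 0 \<or> l = 1" using ij kl by auto
    ultimately show "i = k \<and> j = l" by auto
  qed
  then have \<gamma>_bij: "bij_betw \<gamma> ({..<2 * t} \<times> {..<2}) {..<4 * t}"
    unfolding bij_betw_def
    using \<gamma>_less by (intro conjI card_subset_eq) (auto simp: card_image)
  \<comment> \<open>The codeword \<open>g k l\<close> is orthogonal to the zero codeword; read through \<open>\<gamma>\<close>, this is the correlation.\<close>
  have "correlation (2 * t) F k l = 0" if kl: "\<not> (2 * t dvd k \<and> even l)" for k l
  proof -
    have "g k l \<noteq> all_zero (4 * t)" "g k l \<noteq> all_zero (4 * t) + all_one (4 * t)"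
      using g_triv[of k l] kl by auto
    then have "(\<Sum>c<4 * t. bit_sign (g k l $ c) * bit_sign (all_zero (4 * t) $ c)) = 0"
      by (rule hadamard_code_orthogonal[OF code g_C zero])
    then have "0 = (\<Sum>c<4 * t. bit_sign (g k l $ c))"
      by (simp add: bit_sign_def)
    also have "\<dots> = (\<Sum>ij\<in>{..<2 * t} \<times> {..<2}. bit_sign (g k l $ \<gamma> ij))"
      by (rule sum.reindex_bij_betw[OF \<gamma>_bij, symmetric])
    also have "\<dots> = correlation (2 * t) F k l"
      unfolding correlation_def sum.cartesian_product
      by (intro sum.cong) (auto simp: g_\<gamma>)
    finally show ?thesis by simp
  qed
  moreover have "F i j \<in> {1, -1}" "F (i + 2 * t) j = F i j" for i j
    by (simp_all add: F_def g_per bit_sign_def)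
  moreover have "F i (j + 2) = - F i j" for i j
  proof -
    have "(all_one (4 * t) + g i j) $ 0 = 1 + g i j $ 0" using t dim by simp
    then have "F i (j + 2) = bit_sign 1 * F i j" unfolding F_def g_u by (simp only: bit_sign_add)
    then show ?thesis by (simp add: bit_sign_def)
  qed
  ultimately have "hadamard_function (2 * t) F"
    unfolding hadamard_function_def by (intro conjI allI impI)
  then show ?thesis by (rule exI[of _ F])
qed

section \<open>From Hadamard functions to codes\<close>

text \<open>Translation by \<open>(k, l)\<close> on \<open>C\<^sub>n \<times> C\<^sub>2\<close>, where \<open>c < 2 * n\<close> encodes the pair \<open>(c div 2, c mod 2)\<close>.\<close>
definition coord_shift :: "nat \<Rightarrow> nat \<Rightarrow> nat \<Rightarrow> nat \<Rightarrow> nat" where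
  "coord_shift n k l c = (if c < 2 * n then 2 * ((c div 2 + k) mod n) + (c + l) mod 2 else c)"

lemma coord_shift_div_mod:
  assumes "c < 2 * n"
  shows "coord_shift n k l c div 2 = (c div 2 + k) mod n"
    and "coord_shift n k l c mod 2 = (c + l) mod 2"
    and "coord_shift n k l c < 2 * n"
proof -
  have "(c div 2 + k) mod n < n" "(c + l) mod 2 < 2" using assms by auto
  then have "2 * ((c div 2 + k) mod n) + (c + l) mod 2 < 2 * n" by linarith
  then show "coord_shift n k l c < 2 * n" using assms by (simp add: coord_shift_def)
qed (use assms in \<open>simp_all add: coord_shift_def\<close>)

lemma coord_shift_compose:
  "coord_shift n k l (coord_shift n k' l' c) = coord_shift n (k + k') (l + l') c"
proof (cases "c < 2 * n")
  case True
  note dm = coord_shift_div_mod[OF True, of k' l']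
  have "((c div 2 + k') mod n + k) mod n = (c div 2 + (k + k')) mod n"
    by (simp add: mod_add_left_eq mod_add_right_eq ac_simps)
  moreover have "(coord_shift n k' l' c + l) mod 2 = (c + (l + l')) mod 2"
    using dm(2) by (metis add.assoc add.commute mod_add_left_eq)
  ultimately show ?thesis
    using True dm(1,3) by (simp add: coord_shift_def[of n k l] coord_shift_def[of n "k + k'"])
qed (simp add: coord_shift_def)

lemma coord_shift_cong:
  assumes "k mod n = k' mod n" "l mod 2 = l' mod 2"
  shows "coord_shift n k l = coord_shift n k' l'"
proof
  fix c
  have "(c div 2 + k) mod n = (c div 2 + k') mod n" "(c + l) mod 2 = (c + l') mod 2"
    using assms by (metis mod_add_right_eq)+
  then show "coord_shift n k l c = coord_shift n k' l' c" by (simp add: coord_shift_def)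
qed

lemma coord_shift_0: "coord_shift n 0 0 = id"
  by (auto simp: coord_shift_def fun_eq_iff)

lemma coord_shift_fixed_point:
  assumes "coord_shift n k l c = c" "c < 2 * n"
  shows "n dvd k \<and> even l"
proof -
  have "(c div 2 + k) mod n = c div 2 mod n" "(c + l) mod 2 = c mod 2"
    using coord_shift_div_mod[OF assms(2), of k l] assms by simp_all
  then show ?thesis
    using mod_eq_dvd_iff_nat[of "c div 2" "c div 2 + k" n] mod_eq_dvd_iff_nat[of c "c + l" 2]
    by simp
qed

lemma coord_shift_inverse:
  assumes "n > 0"
  shows "coord_shift n k l \<circ> coord_shift n ((n - 1) * k) l = id"
    and "coord_shift n ((n - 1) * k) l \<circ> coord_shift n k l = id"
proof -
  have "coord_shift n (n * k) (2 * l) = id"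
    unfolding coord_shift_0[of n, symmetric] by (rule coord_shift_cong) auto
  moreover have "k + (n - 1) * k = n * k" using assms by (cases n) auto
  ultimately show "coord_shift n k l \<circ> coord_shift n ((n - 1) * k) l = id"
      "coord_shift n ((n - 1) * k) l \<circ> coord_shift n k l = id"
    by (simp_all add: fun_eq_iff coord_shift_compose mult_2[symmetric] add.commute)
qed

lemma coord_shift_permutes:
  assumes "n > 0"
  shows "coord_shift n k l permutes {..<2 * n}"
proof (rule bij_imp_permutes)
  have "bij (coord_shift n k l)" using coord_shift_inverse[OF assms, of k l] by (intro o_bij)
  then have "inj_on (coord_shift n k l) {..<2 * n}" by (meson bij_is_inj inj_on_subset subset_UNIV)
  moreover have "coord_shift n k l ` {..<2 * n} \<subseteq> {..<2 * n}" using coord_shift_div_mod(3) by blast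
  ultimately show "bij_betw (coord_shift n k l) {..<2 * n} {..<2 * n}"
    by (simp add: bij_betw_def endo_inj_surj)
qed (simp add: coord_shift_def)

lemma sum_coordinates:
  fixes f :: "nat \<Rightarrow> nat \<Rightarrow> 'a::comm_monoid_add"
  shows "(\<Sum>c<2 * n. f (c div 2) (c mod 2)) = (\<Sum>i<n. \<Sum>j<2. f i j)"
proof (induction n)
  case (Suc n)
  have "(\<Sum>j<2. f n j) = f n 0 + f n 1" by (simp add: numeral_2_eq_2)
  then show ?case using Suc.IH by (simp add: add.assoc)
qed simp

text \<open>
  Two translates correlate like \<open>F\<close> and the translate by their quotient, here
  \<open>(k' - k, l' - l)\<close> in a form free of subtraction. The summand changes sign twice under
  \<open>j \<mapsto> j + 2\<close>, which makes it 2-periodic in \<open>j\<close>, and so the sum may be translated.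
\<close>
lemma sum_hadamard_function_shifts:
  assumes F: "hadamard_function n F" and n: "n > 0"
  shows "(\<Sum>i<n. \<Sum>j<2. F (i + k) (j + l) * F (i + k') (j + l')) =
    correlation n F (k' + (n - 1) * k) (l' + 3 * l)"
proof -
  define \<psi> where "\<psi> i j = F i j * F (i + (k' + (n - 1) * k)) (j + (l' + 3 * l))" for i j
  have \<psi>_n: "\<psi> (i + n) j = \<psi> i j" for i j
    using hadamard_functionD(2)[OF F, of i] hadamard_functionD(2)[OF F, of "i + (k' + (n - 1) * k)"]
    by (simp add: \<psi>_def ac_simps)
  have \<psi>_2: "\<psi> i (j + 2) = \<psi> i j" for i j
    using hadamard_functionD(3)[OF F, of i j]
      hadamard_functionD(3)[OF F, of "i + (k' + (n - 1) * k)" "j + (l' + 3 * l)"]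
    by (simp add: \<psi>_def ac_simps)
  have F_n: "F (i + n * m) j = F i j" for i j m
    by (rule periodic_mult[of "\<lambda>i. F i j"]) (rule hadamard_functionD(2)[OF F])
  have F_4: "F i (j + 4) = F i j" for i j
  proof -
    have "F i (j + 2 + 2) = F i j" unfolding hadamard_functionD(3)[OF F] by simp
    moreover have "j + 2 + 2 = j + 4" by simp
    ultimately show ?thesis by (simp only:)
  qed
  have F_4m: "F i (j + 4 * m) = F i j" for i j m
    by (rule periodic_mult[of "F i"]) (rule F_4)
  have "i + k + (k' + (n - 1) * k) = i + k' + n * k" for i
    using n by (cases n) (auto simp: algebra_simps)
  moreover have "j + l + (l' + 3 * l) = j + l' + 4 * l" for j by simp
  ultimately have "\<psi> (i + k) (j + l) = F (i + k) (j + l) * F (i + k') (j + l')" for i j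
    unfolding \<psi>_def by (simp only: F_n F_4m)
  then have "(\<Sum>i<n. \<Sum>j<2. F (i + k) (j + l) * F (i + k') (j + l'))
      = (\<Sum>i<n. \<Sum>j<2. \<psi> (i + k) (j + l))" by simp
  also have "\<dots> = (\<Sum>i<n. \<Sum>j<2. \<psi> (i + k) j)"
    using sum_periodic_shift[of "\<psi> _" 2 l, OF \<psi>_2] by simp
  also have "\<dots> = (\<Sum>i<n. \<Sum>j<2. \<psi> i j)"
    by (rule sum_periodic_shift[of "\<lambda>i. \<Sum>j<2. \<psi> i j" n k]) (simp add: \<psi>_n)
  finally show ?thesis by (simp add: correlation_def \<psi>_def)
qed

lemma inverse_shift_dvd:
  fixes n k k' :: nat
  assumes "n dvd k' + (n - 1) * k" "n > 0"
  shows "k mod n = k' mod n"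
proof -
  have "k' + (n - 1) * k + k = k' + n * k" using assms(2) by (cases n) auto
  then have "(k' + (n - 1) * k + k) mod n = k' mod n" by (simp only: mod_mult_self2)
  then show ?thesis using assms(1) by (metis add_0 dvd_eq_mod_eq_0 mod_add_left_eq)
qed

lemma mod_4_cases:
  fixes l l' :: nat
  assumes "l mod 2 = l' mod 2"
  shows "l mod 4 = l' mod 4 \<or> l' mod 4 = (l + 2) mod 4"
proof -
  define r s where "r = l mod 4" and "s = l' mod 4"
  have "r mod 2 = s mod 2" using assms by (simp add: r_def s_def mod_mod_cancel)
  moreover have "r = 0 \<or> r = 1 \<or> r = 2 \<or> r = 3" "s = 0 \<or> s = 1 \<or> s = 2 \<or> s = 3"
    unfolding r_def s_def by linarith+
  ultimately have "r = s \<or> s = (r + 2) mod 4" by auto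
  then show ?thesis unfolding r_def s_def mod_add_left_eq .
qed

text \<open>The binary word whose entry at \<open>(i, j)\<close> has sign \<open>F(i, j) F(i + k, j + l)\<close>.\<close>
definition codeword :: "nat \<Rightarrow> (nat \<Rightarrow> nat \<Rightarrow> int) \<Rightarrow> nat \<Rightarrow> nat \<Rightarrow> bit vec" where
  "codeword n F k l = vec (2 * n)
     (\<lambda>c. if F (c div 2) (c mod 2) * F (c div 2 + k) (c mod 2 + l) = 1 then 0 else 1)"

text \<open>
  The permutation attached to \<open>codeword n F k l\<close> has to be the inverse of the translation by \<open>(k, l)\<close>,
  because a permutation acts on words through its inverse. The choice of \<open>(k, l)\<close> is immaterial by
  \<open>codeword_eq_iff\<close> below.
\<close>
definition code_perm :: "nat \<Rightarrow> (nat \<Rightarrow> nat \<Rightarrow> int) \<Rightarrow> bit vec \<Rightarrow> nat \<Rightarrow> nat" where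
  "code_perm n F v =
     (case (SOME (k, l). codeword n F k l = v) of (k, l) \<Rightarrow> coord_shift n ((n - 1) * k) l)"

locale hadamard_function_code =
  fixes n :: nat and F :: "nat \<Rightarrow> nat \<Rightarrow> int"
  assumes n: "n > 0" and F: "hadamard_function n F"
begin

abbreviation "w \<equiv> codeword n F"

lemma F_mod: "F (i mod n) j = F i j"
  by (rule periodic_mod[of "\<lambda>i. F i j"]) (rule hadamard_functionD(2)[OF F])

lemma F_square: "F i j * F i j = 1"
  using hadamard_functionD(1)[OF F, of i j] by auto

lemma dim_codeword [simp]: "dim_vec (w k l) = 2 * n" "w k l \<in> carrier_vec (2 * n)"
  by (simp_all add: codeword_def)

lemma bit_sign_codeword:
  assumes "c < 2 * n"
  shows "bit_sign (w k l $ c) = F (c div 2) (c mod 2) * F (c div 2 + k) (c mod 2 + l)"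
  using assms hadamard_functionD(1)[OF F, of "c div 2" "c mod 2"]
    hadamard_functionD(1)[OF F, of "c div 2 + k" "c mod 2 + l"]
  by (auto simp: codeword_def bit_sign_def)

lemma codeword_eqI:
  assumes "dim_vec v = 2 * n"
    "\<And>c. c < 2 * n \<Longrightarrow> bit_sign (v $ c) = F (c div 2) (c mod 2) * F (c div 2 + k) (c mod 2 + l)"
  shows "v = w k l"
  using assms by (intro eq_vecI) (auto simp: bit_sign_codeword simp flip: bit_sign_eq_iff)

lemma codeword_zero: "w 0 0 = all_zero (2 * n)"
  by (rule codeword_eqI[symmetric]) (auto simp: F_square bit_sign_def)

lemma codeword_add_2: "w k (l + 2) = w k l + all_one (2 * n)"
proof (rule codeword_eqI[symmetric])
  fix c assume c: "c < 2 * n"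
  have "F (c div 2 + k) (c mod 2 + (l + 2)) = - F (c div 2 + k) (c mod 2 + l)"
    using hadamard_functionD(3)[OF F, of "c div 2 + k" "c mod 2 + l"] by (simp only: add.assoc)
  moreover have "bit_sign ((w k l + all_one (2 * n)) $ c) = - bit_sign (w k l $ c)"
    using c by (simp add: bit_sign_add) (simp add: bit_sign_def)
  ultimately show "bit_sign ((w k l + all_one (2 * n)) $ c)
      = F (c div 2) (c mod 2) * F (c div 2 + k) (c mod 2 + (l + 2))"
    using c by (simp add: bit_sign_codeword)
qed simp

lemma codeword_one: "w 0 2 = all_one (2 * n)"
  using codeword_add_2[of 0 0] by (simp add: codeword_zero numeral_2_eq_2)

lemma codeword_add_4: "w k (l + 4) = w k l"
proof -
  have "w k (l + 2 + 2) = w k l"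
    unfolding codeword_add_2 by (rule add_all_one_twice) simp
  moreover have "l + 2 + 2 = l + 4" by simp
  ultimately show ?thesis by (simp only:)
qed

lemma codeword_cong:
  assumes "k mod n = k' mod n" "l mod 4 = l' mod 4"
  shows "w k l = w k' l'"
proof -
  have "w (k + n) l = w k l" for k l
    using hadamard_functionD(2)[OF F] by (simp add: codeword_def add.assoc[symmetric])
  from periodic_cong[of "\<lambda>k. w k l" n, OF this assms(1)]
    periodic_cong[of "w k'", OF codeword_add_4 assms(2)]
  show ?thesis by simp
qed

lemma sum_codewords:
  "(\<Sum>c<2 * n. bit_sign (w k l $ c) * bit_sign (w k' l' $ c)) =
     correlation n F (k' + (n - 1) * k) (l' + 3 * l)"
proof -
  have "bit_sign (w k l $ c) * bit_sign (w k' l' $ c) =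
      F (c div 2 + k) (c mod 2 + l) * F (c div 2 + k') (c mod 2 + l')" if "c < 2 * n" for c
    using hadamard_functionD(1)[OF F, of "c div 2" "c mod 2"] that
    by (auto simp: bit_sign_codeword)
  then have "(\<Sum>c<2 * n. bit_sign (w k l $ c) * bit_sign (w k' l' $ c)) =
      (\<Sum>c<2 * n. F (c div 2 + k) (c mod 2 + l) * F (c div 2 + k') (c mod 2 + l'))" by simp
  also have "\<dots> = (\<Sum>i<n. \<Sum>j<2. F (i + k) (j + l) * F (i + k') (j + l'))"
    by (rule sum_coordinates)
  also note sum_hadamard_function_shifts[OF F n]
  finally show ?thesis .
qed

lemma codewords_orthogonal:
  assumes "\<not> (k mod n = k' mod n \<and> l mod 2 = l' mod 2)"
  shows "(\<Sum>c<2 * n. bit_sign (w k l $ c) * bit_sign (w k' l' $ c)) = 0"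
proof -
  have "\<not> (n dvd k' + (n - 1) * k \<and> even (l' + 3 * l))"
    using assms inverse_shift_dvd[OF _ n, of k' k] by (auto simp: mod2_eq_if split: if_splits)
  then show ?thesis using F unfolding sum_codewords by (auto simp: hadamard_function_def)
qed

text \<open>
  Equal words have inner product \<open>2 * n\<close>, so by orthogonality their indices agree modulo \<open>n\<close> and
  modulo 2; a difference of 2 in the second index would make the words complementary.
\<close>
lemma codeword_eq_iff: "w k l = w k' l' \<longleftrightarrow> k mod n = k' mod n \<and> l mod 4 = l' mod 4"
proof
  assume eq: "w k l = w k' l'"
  have "(\<Sum>c<2 * n. bit_sign (w k l $ c) * bit_sign (w k' l' $ c)) = (\<Sum>c<2 * n. 1)"
    unfolding eq by (rule sum.cong) (auto simp: bit_sign_def)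
  then have *: "k mod n = k' mod n" "l mod 2 = l' mod 2"
    using codewords_orthogonal[of k k' l l'] n by auto
  moreover have "l mod 4 = l' mod 4"
  proof (rule ccontr)
    assume "l mod 4 \<noteq> l' mod 4"
    then have "l' mod 4 = (l + 2) mod 4" using mod_4_cases[OF *(2)] by blast
    then have "w k (l + 2) = w k' l'" using *(1) by (intro codeword_cong) simp_all
    then have "w k l = w k (l + 2)" using eq by simp
    then have "bit_sign (w k l $ 0) = bit_sign ((w k l + all_one (2 * n)) $ 0)"
      unfolding codeword_add_2 by (rule arg_cong)
    also have "\<dots> = - bit_sign (w k l $ 0)"
      using n by (simp add: bit_sign_add) (simp add: bit_sign_def)
    finally show False by (simp add: bit_sign_def split: if_splits)
  qed
  ultimately show "k mod n = k' mod n \<and> l mod 4 = l' mod 4" by simp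
qed (blast intro: codeword_cong)

definition "C = {w k l | k l. True}"

lemma codeword_in_C [simp]: "w k l \<in> C" by (auto simp: C_def)

lemma C_E: assumes "v \<in> C" obtains k l where "v = w k l"
  using assms by (auto simp: C_def)

lemma hadamard_code_C: "hadamard_code (2 * n) C"
  unfolding hadamard_code_def
proof (intro conjI exI)
  define H where "H = mat (2 * n) (2 * n) (\<lambda>(r, c). bit_sign (w (r div 2) (r mod 2) $ c))"
  have Hc: "H \<in> carrier_mat (2 * n) (2 * n)" by (simp add: H_def)
  have "(H * transpose_mat H) $$ (r, s) = (if r = s then int (2 * n) else 0)"
    if rs: "r < 2 * n" "s < 2 * n" for r s
  proof -
    have "(H * transpose_mat H) $$ (r, s) =
        (\<Sum>c<2 * n. bit_sign (w (r div 2) (r mod 2) $ c) * bit_sign (w (s div 2) (s mod 2) $ c))"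
      using rs by (auto simp: H_def scalar_prod_def atLeast0LessThan)
    also have "\<dots> = (if r = s then int (2 * n) else 0)"
    proof (cases "r = s")
      case True
      have "bit_sign x * bit_sign x = 1" for x by (simp add: bit_sign_def)
      then show ?thesis using True by simp
    next
      case False
      then have "r div 2 \<noteq> s div 2 \<or> r mod 2 \<noteq> s mod 2" by (metis div_mult_mod_eq)
      moreover have "r div 2 mod n = r div 2" "s div 2 mod n = s div 2" using rs by auto
      ultimately have "\<not> (r div 2 mod n = s div 2 mod n \<and> r mod 2 mod 2 = s mod 2 mod 2)"
        by simp
      from codewords_orthogonal[OF this] show ?thesis using False by simp
    qed
    finally show ?thesis .
  qed
  then show "hadamard_matrix (2 * n) H"
    unfolding hadamard_matrix_def using Hc
    by (intro conjI eq_matI) (auto simp: H_def bit_sign_def)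
  have row: "row (binary_matrix H) r = w (r div 2) (r mod 2)" if "r < 2 * n" for r
  proof (rule eq_vecI)
    fix c assume "c < dim_vec (w (r div 2) (r mod 2))"
    then show "row (binary_matrix H) r $ c = w (r div 2) (r mod 2) $ c"
      using that by (auto simp: H_def binary_matrix_def bit_sign_def)
  qed (use that in \<open>simp add: H_def binary_matrix_def\<close>)
  show "C = (\<Union>r<2 * n. {row (binary_matrix H) r, row (binary_matrix H) r + all_one (2 * n)})"
  proof (intro equalityI subsetI)
    fix v assume "v \<in> C"
    then obtain k l where v: "v = w k l" by (rule C_E)
    define r where "r = 2 * (k mod n) + l mod 2"
    have "k mod n < n" using n by simp
    then have r: "r < 2 * n" unfolding r_def by linarith
    have r_dm: "r div 2 = k mod n" "r mod 2 = l mod 2" by (simp_all add: r_def)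
    have "l mod 2 mod 4 = l mod 4 \<or> l mod 4 = (l mod 2 + 2) mod 4"
      by (rule mod_4_cases) simp
    then have "v = w (r div 2) (r mod 2) \<or> v = w (r div 2) (r mod 2 + 2)"
      unfolding v codeword_eq_iff r_dm mod_mod_trivial by auto
    then have "v = row (binary_matrix H) r \<or> v = row (binary_matrix H) r + all_one (2 * n)"
      unfolding row[OF r] codeword_add_2 .
    then show "v \<in> (\<Union>r<2 * n. {row (binary_matrix H) r, row (binary_matrix H) r + all_one (2 * n)})"
      using r by blast
  next
    fix v assume "v \<in> (\<Union>r<2 * n. {row (binary_matrix H) r, row (binary_matrix H) r + all_one (2 * n)})"
    then obtain r where "r < 2 * n" "v = row (binary_matrix H) r \<or> v = row (binary_matrix H) r + all_one (2 * n)"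
      by auto
    then have "v = w (r div 2) (r mod 2) \<or> v = w (r div 2) (r mod 2 + 2)"
      by (simp only: row codeword_add_2)
    then show "v \<in> C" by auto
  qed
  have "C = (\<lambda>(k, l). w k l) ` ({..<n} \<times> {..<4})"
  proof (intro equalityI subsetI)
    fix v assume "v \<in> C"
    then obtain k l where "v = w k l" by (rule C_E)
    then have "v = w (k mod n) (l mod 4)" by (simp add: codeword_eq_iff)
    then show "v \<in> (\<lambda>(k, l). w k l) ` ({..<n} \<times> {..<4})"
      using n by (intro image_eqI[of _ _ "(k mod n, l mod 4)"]) auto
  qed auto
  moreover have "inj_on (\<lambda>(k, l). w k l) ({..<n} \<times> {..<4})"
    by (auto simp: inj_on_def codeword_eq_iff)
  ultimately show "card C = 2 * (2 * n)" by (simp add: card_image)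
  show "all_zero (2 * n) \<in> C" unfolding codeword_zero[symmetric] by simp
qed

abbreviation "\<pi> \<equiv> code_perm n F"

lemma code_perm_codeword: "\<pi> (w k l) = coord_shift n ((n - 1) * k) l"
proof -
  obtain k' l' where kl': "(SOME (k', l'). w k' l' = w k l) = (k', l')" by fastforce
  have "case (SOME (k', l'). w k' l' = w k l) of (k', l') \<Rightarrow> w k' l' = w k l"
    by (rule someI[of "\<lambda>(k', l'). w k' l' = w k l" "(k, l)"]) simp
  then have "w k' l' = w k l" unfolding kl' prod.case .
  then have kl: "k' mod n = k mod n" "l' mod 4 = l mod 4" unfolding codeword_eq_iff by blast+
  have "((n - 1) * k') mod n = ((n - 1) * k) mod n" by (rule mod_mult_cong[OF refl kl(1)])
  moreover have "l' mod 2 = l mod 2"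
    using arg_cong[where f = "\<lambda>x. x mod 2", OF kl(2)] by (simp add: mod_mod_cancel)
  ultimately have "coord_shift n ((n - 1) * k') l' = coord_shift n ((n - 1) * k) l"
    by (rule coord_shift_cong)
  then show ?thesis by (simp only: code_perm_def kl' prod.case)
qed

lemma permute_codeword:
  "permute_vec (\<pi> (w k l)) (w k' l') = vec (2 * n) (\<lambda>c. w k' l' $ coord_shift n k l c)"
proof -
  have "inv_into UNIV (\<pi> (w k l)) = coord_shift n k l"
    unfolding code_perm_codeword using coord_shift_inverse[OF n, of k l]
    by (intro inv_unique_comp)
  then show ?thesis by (simp add: permute_vec_def)
qed

text \<open>
  The cocycle identity \<open>F(g) F(g x) \<cdot> F(g x) F(g x y) = F(g) F(g x y)\<close> at the coordinate \<open>g\<close>. The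
  wrap-around of the second index modulo 2 is harmless, since it negates both factors of
  \<open>F(g x) F(g x y)\<close>.
\<close>
lemma codeword_mult: "w k l + permute_vec (\<pi> (w k l)) (w k' l') = w (k + k') (l + l')"
  unfolding permute_codeword
proof (rule codeword_eqI)
  fix c assume c: "c < 2 * n"
  let ?i = "c div 2" and ?j = "c mod 2"
  define \<psi> where "\<psi> j = F (?i + k) j * F (?i + (k + k')) (j + l')" for j
  have "\<psi> (j + 2) = \<psi> j" for j
    using hadamard_functionD(3)[OF F, of _ j] hadamard_functionD(3)[OF F, of _ "j + l'"]
    by (simp add: \<psi>_def ac_simps)
  then have \<psi>: "\<psi> ((c + l) mod 2) = \<psi> (?j + l)"
    by (rule periodic_cong) (simp add: mod_add_left_eq)
  have "F ((?i + k) mod n + k') j = F (?i + (k + k')) j" for j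
    using F_mod[of "(?i + k) mod n + k'" j] F_mod[of "?i + (k + k')" j]
    by (simp add: mod_add_left_eq add.assoc)
  then have "bit_sign (w k' l' $ coord_shift n k l c) = \<psi> ((c + l) mod 2)"
    using coord_shift_div_mod[OF c, of k l] by (simp add: bit_sign_codeword F_mod \<psi>_def)
  then have "bit_sign ((w k l + vec (2 * n) (\<lambda>c. w k' l' $ coord_shift n k l c)) $ c)
      = F ?i ?j * F (?i + k) (?j + l) * \<psi> (?j + l)"
    using c by (simp only: index_add_vec index_vec dim_vec bit_sign_add bit_sign_codeword \<psi>)
  also have "\<dots> = F ?i ?j * F (?i + (k + k')) (?j + (l + l'))"
    using hadamard_functionD(1)[OF F, of "?i + k" "?j + l"] by (auto simp: \<psi>_def add.assoc)
  finally show "bit_sign ((w k l + vec (2 * n) (\<lambda>c. w k' l' $ coord_shift n k l c)) $ c)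
      = F ?i ?j * F (?i + (k + k')) (?j + (l + l'))" .
qed simp

lemma propelinear_C: "propelinear_structure (2 * n) C \<pi>"
  unfolding propelinear_structure_def
proof (intro conjI ballI subsetI)
  fix x assume "x \<in> C"
  then obtain k l where x: "x = w k l" by (rule C_E)
  show "x \<in> carrier_vec (2 * n)" by (simp add: x)
  show "\<pi> x permutes {..<2 * n}" by (simp add: x code_perm_codeword coord_shift_permutes n)
  fix y assume "y \<in> C"
  then obtain k' l' where y: "y = w k' l'" by (rule C_E)
  have xy: "x + permute_vec (\<pi> x) y = w (k + k') (l + l')" unfolding x y by (rule codeword_mult)
  show "x + permute_vec (\<pi> x) y \<in> C" by (simp add: xy)
  show "\<pi> x \<circ> \<pi> y = \<pi> (x + permute_vec (\<pi> x) y)"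
    unfolding xy unfolding x y code_perm_codeword
    by (simp add: fun_eq_iff coord_shift_compose distrib_left)
qed

lemma hfp_C: "hfp_code (2 * n) C \<pi>"
  unfolding hfp_code_def
proof (intro conjI ballI allI impI)
  show "hadamard_code (2 * n) C" "propelinear_structure (2 * n) C \<pi>"
    by (rule hadamard_code_C propelinear_C)+
  have "coord_shift n 0 2 = coord_shift n 0 0" by (rule coord_shift_cong) auto
  then show "\<pi> (all_zero (2 * n)) = id" "\<pi> (all_one (2 * n)) = id"
    by (simp_all add: codeword_zero[symmetric] codeword_one[symmetric] code_perm_codeword coord_shift_0)
  fix x i assume x: "x \<in> C - {all_zero (2 * n), all_one (2 * n)}" and i: "i < 2 * n"
  then obtain k l where kl: "x = w k l" using C_E by blast
  show "\<pi> x i \<noteq> i"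
  proof
    assume "\<pi> x i = i"
    then have "n dvd (n - 1) * k \<and> even l"
      using coord_shift_fixed_point[OF _ i] unfolding kl code_perm_codeword by blast
    then have "0 mod n = k mod n" "even l"
      using inverse_shift_dvd[OF _ n, of 0 k] by auto
    moreover from \<open>even l\<close> have "0 mod 4 = l mod 4 \<or> l mod 4 = (0 + 2) mod 4"
      by (intro mod_4_cases) simp
    ultimately have "w k l = w 0 0 \<or> w k l = w 0 2" by (auto simp: codeword_eq_iff)
    then show False using x by (simp add: kl codeword_zero codeword_one)
  qed
qed

lemma code_direct_product:
  defines "G \<equiv> propelinear_group (2 * n) C \<pi>"
  shows "(\<lambda>(x, y). x \<otimes>\<^bsub>G\<^esub> y)
      \<in> iso (subgroup_generated G {w 1 0} \<times>\<times> subgroup_generated G {w 0 1}) G"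
    and "subgroup_generated G {w 1 0} \<cong> integer_mod_group n"
    and "subgroup_generated G {w 0 1} \<cong> integer_mod_group 4"
    and "w 1 0 [^]\<^bsub>G\<^esub> n = all_zero (2 * n)"
    and "w 0 1 [^]\<^bsub>G\<^esub> (2::nat) = all_one (2 * n)"
proof -
  have fin: "finite C"
    using hadamard_code_C n by (intro card_ge_0_finite) (simp add: hadamard_code_def)
  interpret group G
    unfolding G_def using hfp_C fin
    by (intro propelinear_group_is_group) (auto simp: hfp_code_def hadamard_code_def)
  have carrier: "carrier G = C" and one: "\<one>\<^bsub>G\<^esub> = w 0 0"
    and mult: "w k l \<otimes>\<^bsub>G\<^esub> w k' l' = w (k + k') (l + l')" for k l k' l'
    by (simp_all add: G_def propelinear_group_def codeword_zero codeword_mult)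
  have a_pow: "w 1 0 [^]\<^bsub>G\<^esub> i = w i 0" for i :: nat
    by (induction i) (simp_all add: one mult)
  have b_pow: "w 0 1 [^]\<^bsub>G\<^esub> i = w 0 i" for i :: nat
    by (induction i) (simp_all add: one mult)
  have mem: "w 1 0 \<in> carrier G" "w 0 1 \<in> carrier G" by (simp_all add: carrier)
  have a_ord: "w 1 0 [^]\<^bsub>G\<^esub> n = \<one>\<^bsub>G\<^esub>" and b_ord: "w 0 1 [^]\<^bsub>G\<^esub> (4::nat) = \<one>\<^bsub>G\<^esub>"
    unfolding a_pow b_pow one codeword_eq_iff by simp_all
  show "w 1 0 [^]\<^bsub>G\<^esub> n = all_zero (2 * n)" "w 0 1 [^]\<^bsub>G\<^esub> (2::nat) = all_one (2 * n)"
    using a_ord unfolding one codeword_zero b_pow codeword_one by simp_all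
  show "subgroup_generated G {w 1 0} \<cong> integer_mod_group n"
    by (rule subgroup_generated_iso_integer_mod_group[OF mem(1) a_ord n])
      (auto simp: inj_on_def a_pow codeword_eq_iff simp del: One_nat_def)
  show "subgroup_generated G {w 0 1} \<cong> integer_mod_group 4"
    by (rule subgroup_generated_iso_integer_mod_group[OF mem(2) b_ord])
      (auto simp: inj_on_def b_pow codeword_eq_iff simp del: One_nat_def)
  have A: "carrier (subgroup_generated G {w 1 0}) = (\<lambda>i. w i 0) ` {..<n}"
    using carrier_subgroup_generated_torsion[OF mem(1) a_ord n] unfolding a_pow .
  have B: "carrier (subgroup_generated G {w 0 1}) = (\<lambda>i. w 0 i) ` {..<4}"
    using carrier_subgroup_generated_torsion[OF mem(2) b_ord] unfolding b_pow by simp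
  let ?P = "subgroup_generated G {w 1 0} \<times>\<times> subgroup_generated G {w 0 1}"
  show "(\<lambda>(x, y). x \<otimes>\<^bsub>G\<^esub> y) \<in> iso ?P G"
    unfolding iso_def
  proof (intro CollectI conjI)
    show "(\<lambda>(x, y). x \<otimes>\<^bsub>G\<^esub> y) \<in> hom ?P G"
      by (rule homI) (auto simp del: One_nat_def simp: A B carrier mult add.commute)
    show "bij_betw (\<lambda>(x, y). x \<otimes>\<^bsub>G\<^esub> y) (carrier ?P) (carrier G)"
      unfolding bij_betw_def
    proof
      show "inj_on (\<lambda>(x, y). x \<otimes>\<^bsub>G\<^esub> y) (carrier ?P)"
        by (rule inj_onI) (auto simp del: One_nat_def simp: A B mult codeword_eq_iff)
      show "(\<lambda>(x, y). x \<otimes>\<^bsub>G\<^esub> y) ` carrier ?P = carrier G"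
      proof (intro equalityI subsetI)
        fix v assume "v \<in> carrier G"
        then obtain k l where "v = w k l" by (auto simp: carrier elim: C_E)
        then have "v = w (k mod n) 0 \<otimes>\<^bsub>G\<^esub> w 0 (l mod 4)"
          by (simp add: mult codeword_eq_iff)
        then show "v \<in> (\<lambda>(x, y). x \<otimes>\<^bsub>G\<^esub> y) ` carrier ?P"
          using n by (intro image_eqI[of _ _ "(w (k mod n) 0, w 0 (l mod 4))"]) (auto simp del: One_nat_def simp: A B)
      qed (auto simp del: One_nat_def simp: A B mult carrier)
    qed
  qed
qed

end

lemma code_of_hadamard_function:
  assumes t: "t \<ge> 1" and F: "hadamard_function (2 * t) F"
  shows "\<exists>C \<pi>. hfp_2t_4u_code t C \<pi>"
proof -
  interpret hadamard_function_code "2 * t" F by standard (use t F in auto)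
  have "2 * (2 * t) = 4 * t" by simp
  note * = hfp_C code_direct_product
  have "hfp_2t_4u_code t C \<pi>"
    unfolding hfp_2t_4u_code_def Let_def
    using *[unfolded \<open>2 * (2 * t) = 4 * t\<close>] codeword_in_C by blast
  then show ?thesis by blast
qed

section \<open>The equivalence\<close>

theorem mainTheorem10:
  fixes t :: nat
  assumes "t \<ge> 1"
  shows "(\<exists>C \<pi>. hfp_2t_4u_code t C \<pi>) \<longleftrightarrow>
         (\<exists>H. complex_hadamard_matrix (2 * t) H \<and> circulant (2 * t) H)"
proof -
  have "2 * t > 0" using assms by simp
  from circulant_of_hadamard_function[OF this] hadamard_function_of_circulant[OF this]
    hadamard_function_of_code[OF assms] code_of_hadamard_function[OF assms]
  show ?thesis by blast
qed

end
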